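(* Let $K\ge1$ be an integer, $0<\theta_0<\theta^*(K)=\arctan\frac{1}{K(K-1)}$ (with $\theta^*(1)=\pi/2$), and $\alpha=\frac1{2K\tan\theta_0}$. Let $\varphi:\mathbb T^2\times\mathcal C_K^*\to\mathbb T^2\times\mathcal C_K^*$ be the reparametrized first return map, which has the following form: there are a finite set $\mathcal Q$, for each $s\in[0,1)$ a finite partition $\{I_i^s:i\in\mathcal Q\}$ of $\mathbb T^1\times\mathcal C_K^*$ into intervals, and elements $(\gamma_i,\epsilon_i,\xi_i)\in\mathbb T^1\times\{0,1\}\times\mathcal C_K^*$, such that $\varphi(x,s,\xi)=(x+2s+\gamma_i,\ s+\epsilon_i\alpha,\ \xi_i)$ whenever $(x,\xi)\in I_i^s$. If $\alpha$ is rational, then for every $h_0\in\mathbb T^1$ the restriction of $\varphi$ to the finite union of intervals $\mathbb T^1\times\mathcal R_\alpha(h_0)\times\mathcal C_K^*$, where $\mathcal R_\alpha(h_0)=\{h_0+n\alpha \bmod 1: n\in\mathbb Z_{\ge 0}\}$, is an interval translation.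
   Context: $\mathbb T^1=\mathbb R/\mathbb Z$ (also viewed as $[0,1]$ with endpoints identified), $\mathbb T^2=\mathbb T^1\times\mathbb T^1$, $\mathcal C_K^*=\{0,1\}^K\setminus\{(0,\dots,0)\}$. An interval of $\mathbb T^1\times\mathcal C^*_K$ is a (possibly empty) set $I\times\{\xi\}$ with $I$ an arc of $\mathbb T^1$; first two coordinates of $\varphi$ are taken modulo $1$. An interval translation on a finite disjoint union $X$ of copies of $\mathbb T^1$ is a map $X\to X$ (not necessarily bijective) for which there is a finite partition of $X$ into intervals, each contained in one copy, such that the map sends each interval of the partition into a single copy, acting on it by a translation. Origin of $\varphi$ (not needed to read the claim): in the half-strip $0\le x_1\le K$, $x_2\ge -h$ filled with unit square bricks $[z_1,z_1+1]\times[z_2,z_2+1]$, $z_2\ge 0$, a point moves as in a billiard and every brick it hits disappears; $\varphi$ describes the first return to the bottom side $x_2=-h$, for initial angle $\theta_0$, in the coordinates: $x$ = abscissa (unfolded over the two directions) divided by $2K$; $s$ = (height of the lowest remaining brick $+h$) divided by $2K\tan\theta_0$, mod 1; $\xi$ = occupation of the lowest non-empty row. *)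

theory Defs
  imports "HOL-Analysis.Analysis"
begin

quotient_type circle = real / "\<lambda>x y. x - y \<in> \<int>"
proof (rule equivpI)
  show "reflp (\<lambda>x y :: real. x - y \<in> \<int>)"
    by (simp add: reflp_def)
  show "symp (\<lambda>x y :: real. x - y \<in> \<int>)"
    by (metis (mono_tags, lifting) Ints_minus minus_diff_eq sympI)
  show "transp (\<lambda>x y :: real. x - y \<in> \<int>)"
  proof (rule transpI)
    fix x y z :: real
    assume "x - y \<in> \<int>" "y - z \<in> \<int>"
    then have "(x - y) + (y - z) \<in> \<int>" by (rule Ints_add)
    then show "x - z \<in> \<int>" by simp
  qed
qed

lift_definition to_circle :: "real \<Rightarrow> circle" is "\<lambda>x. x" .

instantiation circle :: ab_group_add
begin

lift_definition zero_circle :: circle is 0 .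

lift_definition plus_circle :: "circle \<Rightarrow> circle \<Rightarrow> circle" is "(+)"
  by (metis Ints_add add_diff_add)

lift_definition minus_circle :: "circle \<Rightarrow> circle \<Rightarrow> circle" is "(-)"
proof -
  fix a b c d :: real
  assume "a - b \<in> \<int>" "c - d \<in> \<int>"
  then have "(a - b) - (c - d) \<in> \<int>" by (rule Ints_diff)
  then show "(a - c) - (b - d) \<in> \<int>" by (simp add: algebra_simps)
qed

lift_definition uminus_circle :: "circle \<Rightarrow> circle" is uminus
  by (metis Ints_minus minus_diff_eq minus_diff_minus)

instance
  by standard (transfer; simp)+

end

text \<open>
  The images of real intervals are exactly the connected subsets of the circle: open, closed and
  half-open arcs, single points, the whole circle and the empty set.
\<close>

definition is_arc :: "circle set \<Rightarrow> bool" where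
  "is_arc A \<longleftrightarrow> (\<exists>S. is_interval S \<and> A = to_circle ` S)"

text \<open>Here \<open>J\<close> is the set of labels of the copies of the circle making up \<open>UNIV \<times> J\<close>.\<close>

definition is_interval_of :: "'c set \<Rightarrow> (circle \<times> 'c) set \<Rightarrow> bool" where
  "is_interval_of J A \<longleftrightarrow> (\<exists>I. \<exists>c\<in>J. is_arc I \<and> A = I \<times> {c})"

definition interval_translation_on ::
    "(circle \<times> 'c) set \<Rightarrow> (circle \<times> 'c \<Rightarrow> circle \<times> 'c) \<Rightarrow> bool" where
  "interval_translation_on X f \<longleftrightarrow>
     (\<exists>J. finite J \<and> X = UNIV \<times> J \<and> f \<in> X \<rightarrow> X \<and>
       (\<exists>P. finite P \<and> partition_on X P \<and>
         (\<forall>A\<in>P. is_interval_of J A \<and>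
           (\<exists>\<tau>. \<exists>d\<in>J. \<forall>(x, c)\<in>A. f (x, c) = (x + \<tau>, d)))))"

definition nonzero_configs :: "nat \<Rightarrow> nat list set" where
  "nonzero_configs K = {\<xi>. length \<xi> = K \<and> set \<xi> \<subseteq> {0, 1}} - {replicate K 0}"

definition theta_star :: "nat \<Rightarrow> real" where
  "theta_star K = (if K = 1 then pi / 2 else arctan (1 / (real K * (real K - 1))))"

definition rotation_orbit :: "real \<Rightarrow> circle \<Rightarrow> circle set" where
  "rotation_orbit \<alpha> h = {h + to_circle (real n * \<alpha>) | n :: nat. True}"

end

theory Submission
  imports Defs
begin

text \<open>
  The second coordinate moves by a multiple of \<open>\<alpha>\<close>, hence never leaves the forward orbit of \<open>h\<^sub>0\<close>
  under the rotation by \<open>\<alpha>\<close> (\<open>rotation_orbit_closed\<close>). For rational \<open>\<alpha>\<close> this orbit is finite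
  (\<open>finite_rotation_orbit\<close>), so only finitely many circles, indexed by pairs \<open>(s, \<xi>)\<close>, are involved.
  On the circles with a given \<open>s\<close>, the term \<open>2s\<close> in the formula for \<open>\<phi>\<close> is a constant, so \<open>\<phi>\<close> acts on
  the piece with index \<open>i\<close> as the translation by \<open>2s + \<gamma>\<^sub>i\<close>. Collecting the partitions for the finitely
  many values of \<open>s\<close> gives the finite partition required of an interval translation.
\<close>

lemma to_circle_eq_iff: "to_circle x = to_circle y \<longleftrightarrow> x - y \<in> \<int>"
  by transfer simp

lemma to_circle_add: "to_circle (x + y) = to_circle x + to_circle y"
  by transfer simp

lemma rotation_orbit_closed:
  assumes "s \<in> rotation_orbit \<alpha> h"
  shows "s + to_circle (real k * \<alpha>) \<in> rotation_orbit \<alpha> h"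
proof -
  from assms obtain n where "s = h + to_circle (real n * \<alpha>)"
    unfolding rotation_orbit_def by blast
  then have "s + to_circle (real k * \<alpha>) = h + to_circle (real (n + k) * \<alpha>)"
    by (simp add: distrib_right to_circle_add add.assoc)
  then show ?thesis
    unfolding rotation_orbit_def by blast
qed

text \<open>
  If \<open>b\<alpha>\<close> is an integer with \<open>b > 0\<close>, then \<open>n\<alpha>\<close> modulo 1 depends only on \<open>n mod b\<close>.
\<close>

lemma finite_rotation_orbit:
  assumes "\<alpha> \<in> \<rat>"
  shows "finite (rotation_orbit \<alpha> h)"
proof -
  from assms obtain a b :: int where b: "b > 0" and \<alpha>: "\<alpha> = of_int a / of_int b"
    by (elim Rats_cases') auto
  define m where "m = nat b"
  have m: "m > 0" "real m * \<alpha> = of_int a"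
    using b \<alpha> by (simp_all add: m_def)
  have "to_circle (real n * \<alpha>) = to_circle (real (n mod m) * \<alpha>)" for n
  proof -
    have "real n = real (n mod m) + real m * real (n div m)"
      by (metis mod_mult_div_eq of_nat_add of_nat_mult)
    then have "real n * \<alpha> - real (n mod m) * \<alpha> = real (n div m) * (real m * \<alpha>)"
      by (simp add: algebra_simps)
    also have "\<dots> \<in> \<int>"
      unfolding m(2) by simp
    finally show ?thesis
      by (simp add: to_circle_eq_iff)
  qed
  then have "rotation_orbit \<alpha> h \<subseteq> (\<lambda>n. h + to_circle (real n * \<alpha>)) ` {..<m}"
    using m(1) unfolding rotation_orbit_def
    by (smt (verit) image_eqI lessThan_iff mem_Collect_eq mod_less_divisor subsetI)
  then show ?thesis
    by (rule finite_subset) simp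
qed

lemma finite_nonzero_configs: "finite (nonzero_configs K)"
proof -
  have "finite {\<xi> :: nat list. set \<xi> \<subseteq> {0, 1} \<and> length \<xi> = K}"
    by (rule finite_lists_length_eq) simp
  then show ?thesis
    unfolding nonzero_configs_def by (simp add: conj_commute)
qed

theorem mainTheorem5:
  fixes K :: nat
    and \<theta>\<^sub>0 \<alpha> :: real
    and \<phi> :: "circle \<times> circle \<times> nat list \<Rightarrow> circle \<times> circle \<times> nat list"
    and Q :: "'q set"
    and I :: "'q \<Rightarrow> circle \<Rightarrow> (circle \<times> nat list) set"
    and \<gamma> :: "'q \<Rightarrow> circle"
    and \<epsilon> :: "'q \<Rightarrow> nat"
    and \<xi>' :: "'q \<Rightarrow> nat list"
    and h\<^sub>0 :: circle
  assumes "K \<ge> 1"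
    and "0 < \<theta>\<^sub>0" and "\<theta>\<^sub>0 < theta_star K"
    and "\<alpha> = 1 / (2 * real K * tan \<theta>\<^sub>0)"
    and "\<phi> \<in> UNIV \<times> UNIV \<times> nonzero_configs K \<rightarrow> UNIV \<times> UNIV \<times> nonzero_configs K"
    and "finite Q"
    and "\<And>s i. i \<in> Q \<Longrightarrow> is_interval_of (nonzero_configs K) (I i s)"
    and "\<And>s. disjoint_family_on (\<lambda>i. I i s) Q"
    and "\<And>s. (\<Union>i\<in>Q. I i s) = UNIV \<times> nonzero_configs K"
    and "\<And>i. i \<in> Q \<Longrightarrow> \<epsilon> i \<in> {0, 1}"
    and "\<And>i. i \<in> Q \<Longrightarrow> \<xi>' i \<in> nonzero_configs K"
    and "\<And>i s x \<xi>. i \<in> Q \<Longrightarrow> (x, \<xi>) \<in> I i s \<Longrightarrow>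
           \<phi> (x, s, \<xi>) = (x + (s + s) + \<gamma> i, s + to_circle (real (\<epsilon> i) * \<alpha>), \<xi>' i)"
    and "\<alpha> \<in> \<rat>"
  shows "interval_translation_on (UNIV \<times> rotation_orbit \<alpha> h\<^sub>0 \<times> nonzero_configs K)
           (restrict \<phi> (UNIV \<times> rotation_orbit \<alpha> h\<^sub>0 \<times> nonzero_configs K))"
proof -
  let ?R = "rotation_orbit \<alpha> h\<^sub>0"
  let ?C = "nonzero_configs K"
  let ?X = "(UNIV :: circle set) \<times> ?R \<times> ?C"
  define cell where "cell i s = (\<lambda>(x, \<xi>). (x, s, \<xi>)) ` I i s" for i s
  \<comment> \<open>Some \<open>I i s\<close> may be empty, whereas the blocks of a partition must not be.\<close>
  define P where "P = (\<lambda>(i, s). cell i s) ` (Q \<times> ?R) - {{}}"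
  have mem_cell: "(x, t, \<xi>) \<in> cell i s \<longleftrightarrow> t = s \<and> (x, \<xi>) \<in> I i s" for x t \<xi> i s
    unfolding cell_def by force
  have unique: "i = j" if "i \<in> Q" "j \<in> Q" "p \<in> I i s" "p \<in> I j s" for i j p s
    using assms(8)[of s] that unfolding disjoint_family_on_def by blast
  have cover: "(\<exists>i\<in>Q. (x, \<xi>) \<in> I i s) \<longleftrightarrow> \<xi> \<in> ?C" for x \<xi> s
    using assms(9)[of s] by blast
  have "finite P"
    unfolding P_def using \<open>finite Q\<close> finite_rotation_orbit[OF \<open>\<alpha> \<in> \<rat>\<close>] by simp
  moreover have "partition_on ?X P"
  proof (rule partition_onI)
    have "(x, s, \<xi>) \<in> \<Union>P \<longleftrightarrow> (x, s, \<xi>) \<in> ?X" for x s \<xi>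
    proof -
      have "(x, s, \<xi>) \<in> \<Union>P \<longleftrightarrow> (\<exists>i\<in>Q. \<exists>t\<in>?R. (x, s, \<xi>) \<in> cell i t)"
        unfolding P_def by blast
      also have "\<dots> \<longleftrightarrow> (x, s, \<xi>) \<in> ?X"
        using cover[of x \<xi> s] by (auto simp: mem_cell)
      finally show ?thesis .
    qed
    then show "\<Union>P = ?X"
      by (metis prod_cases3 subsetI subset_antisym)
  next
    fix A B assume "A \<in> P" "B \<in> P" "A \<noteq> B"
    then obtain i s j t where "i \<in> Q" "j \<in> Q" and A: "A = cell i s" and B: "B = cell j t"
      unfolding P_def by auto
    then have "A = B" if "(x, u, \<xi>) \<in> A" "(x, u, \<xi>) \<in> B" for x u \<xi>
      using that unique[of i j "(x, \<xi>)" u] by (auto simp: mem_cell)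
    with \<open>A \<noteq> B\<close> show "disjnt A B"
      unfolding disjnt_def by auto
  qed (simp add: P_def)
  moreover have "is_interval_of (?R \<times> ?C) A \<and>
      (\<exists>\<tau>. \<exists>d\<in>?R \<times> ?C. \<forall>(x, c)\<in>A. restrict \<phi> ?X (x, c) = (x + \<tau>, d))"
    if "A \<in> P" for A
  proof
    from that obtain i s where i: "i \<in> Q" and s: "s \<in> ?R" and A: "A = cell i s"
      unfolding P_def by auto
    from assms(7)[OF i, of s] obtain S \<xi>
      where "\<xi> \<in> ?C" "is_arc S" and I_eq: "I i s = S \<times> {\<xi>}"
      unfolding is_interval_of_def by blast
    moreover have "A = S \<times> {(s, \<xi>)}"
      unfolding A cell_def I_eq by force
    ultimately show "is_interval_of (?R \<times> ?C) A"
      unfolding is_interval_of_def using s by blast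
    have "restrict \<phi> ?X (x, c) = (x + ((s + s) + \<gamma> i), s + to_circle (real (\<epsilon> i) * \<alpha>), \<xi>' i)"
      if xc: "(x, c) \<in> A" for x c
    proof -
      obtain \<eta> where c: "c = (s, \<eta>)" and x: "(x, \<eta>) \<in> I i s"
        using xc unfolding A cell_def by auto
      moreover have "\<eta> \<in> ?C"
        using cover i x by blast
      ultimately show ?thesis
        using s assms(12)[OF i x] by (simp add: add.assoc)
    qed
    moreover have "(s + to_circle (real (\<epsilon> i) * \<alpha>), \<xi>' i) \<in> ?R \<times> ?C"
      using rotation_orbit_closed[OF s] assms(11)[OF i] by simp
    ultimately show "\<exists>\<tau>. \<exists>d\<in>?R \<times> ?C. \<forall>(x, c)\<in>A. restrict \<phi> ?X (x, c) = (x + \<tau>, d)"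
      by blast
  qed
  moreover have "restrict \<phi> ?X \<in> ?X \<rightarrow> ?X"
  proof (rule funcsetI)
    fix p assume "p \<in> ?X"
    then obtain x s \<xi> where p: "p = (x, s, \<xi>)" and s: "s \<in> ?R" and \<xi>: "\<xi> \<in> ?C"
      by blast
    with cover obtain i where i: "i \<in> Q" "(x, \<xi>) \<in> I i s"
      by blast
    show "restrict \<phi> ?X p \<in> ?X"
      using p s \<xi> rotation_orbit_closed[OF s] assms(11)[OF i(1)] assms(12)[OF i]
      by simp
  qed
  moreover have "finite (?R \<times> ?C)"
    using finite_rotation_orbit[OF \<open>\<alpha> \<in> \<rat>\<close>] finite_nonzero_configs by blast
  ultimately show ?thesis
    unfolding interval_translation_on_def
    by (intro exI[of _ "?R \<times> ?C"] exI[of _ P] conjI ballI) simp_all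
qed

end
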